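(* Let $K$ be a strictly convex domain in $\mathbb R^2$ whose boundary $\partial K$ is an oval, and let $W_K$ denote the convex body whose boundary is the Wigner caustic type curve associated with $\partial K$, this curve being assumed to be an oval. Then $$\left|\widetilde{A}_{\mathrm{CWMS}(\partial K)}\right|\geqslant\max\left\{4\pi d_\infty^2(K,W_K),\ 6\,d_2^2(K,W_K)\right\},$$ where $\widetilde{A}_{\mathrm{CWMS}(\partial K)}$ is the oriented area of the Constant Width Measure Set of $\partial K$.
   Context: An oval is a $C^\infty$ regular simple closed convex planar curve (signed curvature nowhere zero, of constant sign); orient ovals positively. For an oval $M$ of length $L_M$ with an origin inside and Minkowski support function $p_M(\theta)$, $M$ is parameterized by $\gamma(\theta)=(p_M\cos\theta-p_M'\sin\theta,\ p_M\sin\theta+p_M'\cos\theta)$. Parallel pairs (ordered pairs of distinct points with parallel tangent lines) are $\gamma(\theta),\gamma(\theta+\pi)$. Constant Width Measure Set: $\mathrm{CWMS}(M)=\{a-b+\frac{L_M}{\pi}\mathbf n(a): a,b\text{ a parallel pair of }M\}$, with $\mathbf n(\gamma(\theta))=-(\cos\theta,\sin\theta)$; it is parameterized by $\gamma(\theta)-\gamma(\theta+\pi)+\frac{L_M}{\pi}\mathbf n(\gamma(\theta))$, $\theta\in[0,2\pi]$. The oriented area of an oriented closed curve $C$ is $\widetilde A_C=\frac12\int_C -y\,dx+x\,dy$ (zero if $C$ is a point). The Wigner caustic type curve $W_M$ associated with $M$ is the curve with support function $p_{W_M}(\theta)=\frac{L_M}{2\pi}+\frac{p_M(\theta)-p_M(\theta+\pi)}{2}$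 (it need not be an oval in general). $d_\infty(K,N)=\max_\theta|p_{\partial K}(\theta)-p_{\partial N}(\theta)|$ and $d_2(K,N)=\left(\int_0^{2\pi}|p_{\partial K}(\theta)-p_{\partial N}(\theta)|^2d\theta\right)^{1/2}$. *)

theory Defs
  imports "HOL-Analysis.Analysis"
begin

section \<open>Closed plane curves and ovals\<close>

type_synonym plane = "real \<times> real"

definition vel :: "(real \<Rightarrow> plane) \<Rightarrow> real \<Rightarrow> plane" where
  "vel c t = vector_derivative c (at t)"

definition det2 :: "plane \<Rightarrow> plane \<Rightarrow> real" where
  "det2 u v = fst u * snd v - snd u * fst v"

definition smooth_curve :: "(real \<Rightarrow> plane) \<Rightarrow> bool" where
  "smooth_curve c \<longleftrightarrow> (\<forall>n t. (vel ^^ n) c differentiable (at t))"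

definition signed_curvature :: "(real \<Rightarrow> plane) \<Rightarrow> real \<Rightarrow> real" where
  "signed_curvature c t = det2 (vel c t) (vel (vel c) t) / norm (vel c t) ^ 3"

text \<open>
  A positively oriented oval, given by a parametrization with period \<open>T\<close>, traversed once
  on \<open>[0, T)\<close>.  A simple closed regular curve with curvature of constant sign bounds a convex
  set, and the sign is positive exactly when the curve is traversed anticlockwise, so positivity
  of the curvature covers both convexity and orientation.
\<close>

definition oval :: "(real \<Rightarrow> plane) \<Rightarrow> real \<Rightarrow> bool" where
  "oval c T \<longleftrightarrow> 0 < T \<and> smooth_curve c \<and> (\<forall>t. c (t + T) = c t) \<and> inj_on c {0..<T}
     \<and> (\<forall>t. vel c t \<noteq> 0) \<and> (\<forall>t. 0 < signed_curvature c t)"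

definition curve_length :: "(real \<Rightarrow> plane) \<Rightarrow> real \<Rightarrow> real" where
  "curve_length c T = integral {0..T} (\<lambda>t. norm (vel c t))"

text \<open>\<open>1/2 \<integral> -y dx + x dy\<close> along \<open>c\<close>, parametrized over \<open>[0, T]\<close>.\<close>

definition oriented_area :: "(real \<Rightarrow> plane) \<Rightarrow> real \<Rightarrow> real" where
  "oriented_area c T = 1/2 * integral {0..T}
     (\<lambda>t. - snd (c t) * fst (vel c t) + fst (c t) * snd (vel c t))"


section \<open>Support functions\<close>

definition dir :: "real \<Rightarrow> plane" where
  "dir \<theta> = (cos \<theta>, sin \<theta>)"

definition support_fun :: "plane set \<Rightarrow> real \<Rightarrow> real" where
  "support_fun M \<theta> = (SUP x\<in>M. x \<bullet> dir \<theta>)"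

text \<open>The curve with support function \<open>p\<close>; it need not bound a convex set.\<close>

definition support_curve :: "(real \<Rightarrow> real) \<Rightarrow> real \<Rightarrow> plane" where
  "support_curve p \<theta> =
     (p \<theta> * cos \<theta> - deriv p \<theta> * sin \<theta>, p \<theta> * sin \<theta> + deriv p \<theta> * cos \<theta>)"

text \<open>
  Stated through closure and interior so that it applies equally to open convex domains and to
  convex bodies; only the boundary matters below.
\<close>

definition strictly_convex :: "plane set \<Rightarrow> bool" where
  "strictly_convex K \<longleftrightarrow>
     (\<forall>x\<in>closure K. \<forall>y\<in>closure K. x \<noteq> y \<longrightarrow> open_segment x y \<subseteq> interior K)"

definition convex_body :: "plane set \<Rightarrow> bool" where
  "convex_body S \<longleftrightarrow> convex S \<and> compact S \<and> interior S \<noteq> {}"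

text \<open>
  The two distances between the support functions of the boundaries.  Support functions of bounded
  sets are continuous and \<open>2 * pi\<close>-periodic, so the supremum in \<open>d_inf\<close> is the maximum over all
  angles.
\<close>

definition d_inf :: "plane set \<Rightarrow> plane set \<Rightarrow> real" where
  "d_inf K N = (SUP \<theta>. \<bar>support_fun (frontier K) \<theta> - support_fun (frontier N) \<theta>\<bar>)"

definition d_two :: "plane set \<Rightarrow> plane set \<Rightarrow> real" where
  "d_two K N = sqrt (integral {0..2*pi}
     (\<lambda>\<theta>. \<bar>support_fun (frontier K) \<theta> - support_fun (frontier N) \<theta>\<bar>\<^sup>2))"


section \<open>Constant Width Measure Set and Wigner caustic type curve\<close>

text \<open>
  Both depend on an oval \<open>M\<close> through its support function \<open>p\<close> and its length \<open>L\<close>.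

  The points of \<open>M\<close> with parallel tangents are \<open>support_curve p \<theta>\<close> and
  \<open>support_curve p (\<theta> + pi)\<close>, and the unit normal at the former is \<open>- dir \<theta>\<close>.  Hence, as
  \<open>\<theta>\<close> runs through \<open>[0, 2 * pi]\<close>, the following curve traverses the set of all
  \<open>a - b + (L / pi) n(a)\<close> for parallel pairs \<open>(a, b)\<close> of \<open>M\<close>.  It is this parametrization that
  orients the Constant Width Measure Set.
\<close>

definition cwms_curve :: "(real \<Rightarrow> real) \<Rightarrow> real \<Rightarrow> real \<Rightarrow> plane" where
  "cwms_curve p L \<theta> =
     support_curve p \<theta> - support_curve p (\<theta> + pi) + (L / pi) *\<^sub>R (- dir \<theta>)"

definition wigner_support :: "(real \<Rightarrow> real) \<Rightarrow> real \<Rightarrow> real \<Rightarrow> real" where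
  "wigner_support p L \<theta> = L / (2 * pi) + (p \<theta> - p (\<theta> + pi)) / 2"

definition wigner_curve :: "(real \<Rightarrow> real) \<Rightarrow> real \<Rightarrow> real \<Rightarrow> plane" where
  "wigner_curve p L = support_curve (wigner_support p L)"

end

theory Submission
  imports Defs
begin

text \<open>
  Write \<open>q(\<theta>) = p(\<theta>) + p(\<theta> + \<pi>) - L/\<pi>\<close> for the deviation of the width of \<open>K\<close> from its mean.
  Both sides of the inequality depend on \<open>q\<close> alone.  The Constant Width Measure Set is the curve
  with support function \<open>q\<close>, so its oriented area is \<open>1/2 \<integral> (q\<^sup>2 - q'\<^sup>2)\<close> over a full turn; and the
  support functions of \<open>K\<close> and of \<open>W\<close> differ by exactly \<open>q/2\<close>.  The function \<open>q\<close> has period \<open>\<pi>\<close>,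
  and its mean vanishes by Cauchy's formula \<open>L = \<integral> p\<close> over a full turn.  With
  \<open>E = \<integral> (q'\<^sup>2 - q\<^sup>2)\<close> over \<open>[0, \<pi>]\<close>, the claim becomes two inequalities for \<open>\<pi>\<close>-periodic functions of
  mean zero: \<open>E \<ge> \<pi> q(\<theta>)\<^sup>2\<close> at every \<open>\<theta>\<close>, and \<open>E \<ge> 3 \<integral> q\<^sup>2\<close>.

  In terms of Fourier series the second is Wirtinger's inequality, and the first follows from
  \<open>\<Sum> 1/(4k\<^sup>2 - 1) = 1/2\<close> and Cauchy--Schwarz.  The proofs below avoid series: both inequalities
  reduce to \<open>\<integral> r'\<^sup>2 \<ge> k\<^sup>2 \<integral> r\<^sup>2\<close> for \<open>r\<close> vanishing at the ends of an interval of length \<open>\<pi>/k\<close>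
  (\<open>wirtinger_dirichlet\<close>), which holds because \<open>r'\<^sup>2 - k\<^sup>2 r\<^sup>2\<close> is a square plus the derivative of
  \<open>k r\<^sup>2 cot\<close>.  One gets \<open>wirtinger_periodic\<close> by subtracting a value that \<open>q\<close> takes at two points
  half a period apart, and \<open>mean_zero_pointwise_bound\<close> by subtracting the extremal function
  of the first inequality.

  The geometric part justifies treating \<open>p\<close> as a twice continuously differentiable function.  The
  curvature of the oval \<open>c\<close> is positive, so its tangent angle \<open>\<beta>\<close>, recorded as the angle of the outer
  normal, is a strictly increasing bijection of the line.  The tangent at \<open>c(t)\<close> supports \<open>K\<close>, hence \<open>p(\<beta>(t)) = c(t) \<bullet> (cos \<beta>(t), sin \<beta>(t))\<close>, and
  everything about \<open>p\<close>, Cauchy's formula included, follows by differentiating along the inverse of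
  \<open>\<beta>\<close> (\<open>oval_support_function\<close>).  For \<open>W\<close> it remains to see that the function \<open>w\<close> generating the
  boundary curve is the support function of that curve (\<open>support_fun_support_curve\<close>); this
  holds as soon as the radius of curvature \<open>w + w''\<close> is positive.  Its sign is constant because the
  curve is regular, and it is positive because the integral of \<open>w + w''\<close> is \<open>L\<close>.
\<close>

section \<open>Derivatives, integrals and periodicity\<close>

lemma continuous_on_of_derivative:
  fixes f f' :: "real \<Rightarrow> real"
  assumes "\<And>x. (f has_real_derivative f' x) (at x)"
  shows "continuous_on S f"
  using assms by (intro continuous_at_imp_continuous_on ballI DERIV_isCont)

lemma antiderivative_exists:
  fixes f :: "real \<Rightarrow> real"
  assumes "continuous_on UNIV f"
  obtains F where "\<And>x. (F has_real_derivative f x) (at x)"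
proof -
  have "\<exists>F. \<forall>x :: real. (-\<infinity>::ereal) < x \<longrightarrow> x < (\<infinity>::ereal) \<longrightarrow> (F has_vector_derivative f x) (at x)"
    by (rule einterval_antiderivative) (use assms in \<open>auto simp: continuous_on_eq_continuous_at\<close>)
  then show ?thesis
    using that by (auto simp: has_real_derivative_iff_has_vector_derivative)
qed

lemma has_integral_derivative:
  fixes f F :: "real \<Rightarrow> real"
  assumes "\<And>x. (F has_real_derivative f x) (at x)" "a \<le> b"
  shows "(f has_integral F b - F a) {a..b}"
  using assms
  by (intro fundamental_theorem_of_calculus)
     (auto simp: has_real_derivative_iff_has_vector_derivative[symmetric] intro: DERIV_subset)

lemma derivative_periodic:
  fixes f f' :: "real \<Rightarrow> real"
  assumes der: "\<And>x. (f has_real_derivative f' x) (at x)" and per: "\<And>x. f (x + P) = f x"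
  shows "f' (x + P) = f' x"
proof -
  have "((\<lambda>x. f (x + P)) has_real_derivative f' (x + P)) (at x)"
    using der[of "x + P"] by (simp add: DERIV_shift)
  then show ?thesis using der[of x] by (simp add: per DERIV_unique)
qed

lemma integral_periodic_shift:
  fixes f :: "real \<Rightarrow> real"
  assumes cont: "continuous_on UNIV f" and per: "\<And>x. f (x + P) = f x" and P: "0 \<le> P"
  shows "integral {a..a+P} f = integral {b..b+P} f"
proof -
  obtain F where F: "\<And>x. (F has_real_derivative f x) (at x)"
    using antiderivative_exists[OF cont] by blast
  have "((\<lambda>x. F (x + P) - F x) has_real_derivative 0) (at x)" for x
    using DERIV_diff[OF DERIV_shift[THEN iffD1, OF F[of "x+P"]] F[of x]] by (simp add: per)
  then have "F (a + P) - F a = F (b + P) - F b"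
    using DERIV_isconst_all[of "\<lambda>x. F (x + P) - F x"] by blast
  moreover have "integral {z..z+P} f = F (z + P) - F z" for z
    using has_integral_derivative[OF F, of z "z+P"] P by (simp add: integral_unique)
  ultimately show ?thesis by simp
qed

lemma integral_double_period:
  fixes f :: "real \<Rightarrow> real"
  assumes "continuous_on UNIV f" "\<And>x. f (x + P) = f x" "0 \<le> P"
  shows "integral {0..2 * P} f = 2 * integral {0..P} f"
proof -
  have "integral {0..P} f + integral {P..2 * P} f = integral {0..2 * P} f"
    using assms by (intro Henstock_Kurzweil_Integration.integral_combine integrable_continuous_real)
      (auto intro: continuous_on_subset)
  moreover have "integral {P..P + P} f = integral {0..0 + P} f"
    using assms by (rule integral_periodic_shift)
  ultimately show ?thesis by simp
qed

lemma periodic_representative: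
  assumes per: "\<And>t. f (t + T) = f t" and T: "0 < (T :: real)"
  obtains n :: int where "0 \<le> t + of_int n * T" "t + of_int n * T < T" "f (t + of_int n * T) = f t"
proof -
  interpret periodic_fun_simple f T by standard (rule per)
  define n where "n = - \<lfloor>t / T\<rfloor>"
  have t: "t = (t / T) * T" using T by simp
  have "of_int \<lfloor>t / T\<rfloor> * T \<le> t" "t < (of_int \<lfloor>t / T\<rfloor> + 1) * T"
    using T by (subst (2) t, intro mult_right_mono, auto, subst t, intro mult_strict_right_mono, auto)
  then show ?thesis using that[of n] plus_of_int[of t n] by (simp add: n_def algebra_simps)
qed

text \<open>
  The difference of \<open>\<beta>\<close> and the linear function \<open>(D/T) t\<close> is periodic, and monotonicity makes \<open>D\<close>
  positive; hence \<open>\<beta>\<close> is unbounded in both directions.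
\<close>

lemma lift_of_circle_map_bij:
  fixes \<beta> \<omega> :: "real \<Rightarrow> real"
  assumes der: "\<And>t. (\<beta> has_real_derivative \<omega> t) (at t)" and pos: "\<And>t. 0 < \<omega> t"
    and T: "0 < T" and shift: "\<And>t. \<beta> (t + T) = \<beta> t + D"
  shows "strict_mono \<beta>" "surj \<beta>"
proof -
  show mono: "strict_mono \<beta>"
    by (rule strict_monoI, rule DERIV_pos_imp_increasing) (use der pos in blast)+
  have D: "0 < D" using strict_monoD[OF mono, of 0 T] shift[of 0] T by simp
  interpret periodic_fun_simple "\<lambda>t. \<beta> t - D / T * t" T
    by standard (use T in \<open>simp add: shift field_simps\<close>)
  have it: "\<beta> (of_int n * T) = \<beta> 0 + of_int n * D" for n
    using plus_of_int[of 0 n] T by (simp add: field_simps)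
  have cont: "isCont \<beta> x" for x using der DERIV_isCont by blast
  show "surj \<beta>"
  proof -
    have "\<exists>t. \<beta> t = y" for y
    proof -
      define x where "x = (y - \<beta> 0) / D"
      have "of_int \<lfloor>x\<rfloor> * D \<le> x * D" "x * D \<le> of_int (\<lfloor>x\<rfloor> + 1) * D"
        using D by (auto intro!: mult_right_mono)
      then have "\<beta> (of_int \<lfloor>x\<rfloor> * T) \<le> y" "y \<le> \<beta> (of_int (\<lfloor>x\<rfloor> + 1) * T)"
        using D unfolding it by (auto simp: x_def)
      then show ?thesis using T cont
        IVT[of \<beta> "of_int \<lfloor>x\<rfloor> * T" y "of_int (\<lfloor>x\<rfloor> + 1) * T"] by (auto simp: mult_right_mono)
    qed
    then show ?thesis by (metis surjI)
  qed
qed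

lemma DERIV_inv_strict_mono:
  fixes \<beta> \<omega> :: "real \<Rightarrow> real"
  assumes der: "\<And>t. (\<beta> has_real_derivative \<omega> t) (at t)" and pos: "\<And>t. 0 < \<omega> t"
    and mono: "strict_mono \<beta>" and surj: "surj \<beta>"
  shows "(inv \<beta> has_real_derivative 1 / \<omega> (inv \<beta> x)) (at x)"
proof -
  have inj: "inj \<beta>" using mono by (rule strict_mono_imp_inj_on)
  have "(inv \<beta> has_derivative (\<lambda>h. 1 / \<omega> (inv \<beta> x) * h)) (at (\<beta> (inv \<beta> x)))"
  proof (rule has_derivative_inverse_strong[of UNIV _ \<beta> _ "\<lambda>h. \<omega> (inv \<beta> x) * h"])
    show "continuous_on UNIV \<beta>"
      by (rule continuous_on_of_derivative[OF der])
    show "(\<beta> has_derivative (\<lambda>h. \<omega> (inv \<beta> x) * h)) (at (inv \<beta> x))"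
      using der[of "inv \<beta> x"] by (simp add: has_field_derivative_def)
    show "(\<lambda>h. \<omega> (inv \<beta> x) * h) \<circ> (\<lambda>h. 1 / \<omega> (inv \<beta> x) * h) = id"
      using pos[of "inv \<beta> x"] by (auto simp: fun_eq_iff)
  qed (use inj in auto)
  then show ?thesis by (simp only: has_field_derivative_def surj_f_inv_f[OF surj])
qed

lemma nonvanishing_imp_pos:
  fixes \<rho> R :: "real \<Rightarrow> real"
  assumes cont: "continuous_on UNIV \<rho>" and nz: "\<And>x. \<rho> x \<noteq> 0"
    and dR: "\<And>x. (R has_real_derivative \<rho> x) (at x)" and ab: "a < b" "R a \<le> R b"
  shows "0 < \<rho> x"
proof (rule ccontr)
  assume "\<not> 0 < \<rho> x"
  then have neg: "\<rho> x \<le> 0" by simp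
  have "connected (range \<rho>)" using cont connected_UNIV by (rule connected_continuous_image)
  then have "\<rho> y < 0" for y
    using connectedD_interval[of "range \<rho>" "\<rho> x" "\<rho> y" 0] neg nz by fastforce
  then have "R b < R a"
    using dR by (intro DERIV_neg_imp_decreasing[OF ab(1)]) blast
  then show False using ab by simp
qed

section \<open>Inequalities of Wirtinger type\<close>

lemma quotient_of_zeros_tendsto:
  fixes r s :: "real \<Rightarrow> real"
  assumes "(r has_real_derivative r') (at e)" "(s has_real_derivative s') (at e)"
    and "r e = 0" "s e = 0" "s' \<noteq> 0"
  shows "((\<lambda>x. r x / s x) \<longlongrightarrow> r' / s') (at e)"
proof -
  have "((\<lambda>x. ((r x - r e) / (x - e)) / ((s x - s e) / (x - e))) \<longlongrightarrow> r' / s') (at e)"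
    using assms by (intro tendsto_divide) (auto simp: has_field_derivative_iff)
  then show ?thesis
    by (rule Lim_transform_eventually) (auto simp: eventually_at_filter assms)
qed

text \<open>
  With \<open>cot\<close> taken at \<open>k(x - a)\<close>, one has
  \<open>r'\<^sup>2 - k\<^sup>2 r\<^sup>2 = (r' - k r cot)\<^sup>2 + (k r\<^sup>2 cot)'\<close>, and \<open>k r\<^sup>2 cot\<close> tends to \<open>0\<close> at both ends, where the
  simple zero of the sine is cancelled by one of the two zeros of \<open>r\<^sup>2\<close>.
\<close>

lemma wirtinger_dirichlet:
  fixes r r' :: "real \<Rightarrow> real"
  assumes der: "\<And>x. (r has_real_derivative r' x) (at x)" and cont: "continuous_on UNIV r'"
    and k: "0 < k" and zero: "r a = 0" "r (a + pi / k) = 0"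
  shows "0 \<le> integral {a..a + pi/k} (\<lambda>x. (r' x)\<^sup>2 - k\<^sup>2 * (r x)\<^sup>2)"
proof -
  define b where "b = a + pi / k"
  have ab: "a < b" using k by (simp add: b_def)
  define S C where "S x = sin (k * (x - a))" and "C x = cos (k * (x - a))" for x
  have dS: "(S has_real_derivative k * C x) (at x)" for x
    unfolding S_def C_def by (auto intro!: derivative_eq_intros)
  have dC: "(C has_real_derivative - (k * S x)) (at x)" for x
    unfolding S_def C_def by (auto intro!: derivative_eq_intros)
  have kb: "k * (b - a) = pi" using k by (simp add: b_def)
  have Sa: "S a = 0" "S b = 0" "C a = 1" "C b = -1" by (simp_all add: S_def C_def kb)
  have Spos: "0 < S x" if "a < x" "x < b" for x
  proof -
    have "k * (x - a) < k * (b - a)" using that k by (intro mult_strict_left_mono) auto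
    then show ?thesis unfolding S_def using that k kb by (intro sin_gt_zero) auto
  qed
  \<comment> \<open>The function \<open>k r\<^sup>2 cot\<close>.  Division by zero gives it the value \<open>0\<close> at both ends, which is its
    limit there, so that it is continuous on the closed interval.\<close>
  define F where "F x = k * (r x * (r x / S x) * C x)" for x
  define f where "f x = k * (2 * r x * r' x * (C x / S x)) - k\<^sup>2 * (r x)\<^sup>2 * (1 + (C x / S x)\<^sup>2)" for x
  have dF: "(F has_real_derivative f x) (at x)" if "a < x" "x < b" for x
  proof -
    have s: "S x \<noteq> 0" using Spos[OF that] by simp
    show ?thesis unfolding F_def f_def
      by (rule derivative_eq_intros der dS dC refl | rule s)+
         (use s in \<open>simp add: field_simps power2_eq_square\<close>)
  qed
  have contr: "isCont r x" for x using der DERIV_isCont by blast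
  have contC: "isCont C x" for x using dC DERIV_isCont by blast
  have end_cont: "isCont F e" if e: "r e = 0" "S e = 0" "C e \<noteq> 0" for e
  proof -
    have "((\<lambda>x. r x / S x) \<longlongrightarrow> r' e / (k * C e)) (at e)"
      using quotient_of_zeros_tendsto[OF der dS e(1,2)] k e(3) by simp
    then have "(F \<longlongrightarrow> k * (r e * (r' e / (k * C e)) * C e)) (at e)"
      unfolding F_def using contr contC unfolding isCont_def
      by (intro tendsto_mult tendsto_const) auto
    then show ?thesis by (simp add: isCont_def F_def e)
  qed
  have "continuous_on {a..b} F"
  proof (intro continuous_at_imp_continuous_on ballI)
    fix x assume "x \<in> {a..b}"
    then consider "x = a" | "x = b" | "a < x" "x < b" by fastforce
    then show "isCont F x"
    proof cases
      case 1 then show ?thesis using end_cont Sa zero by simp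
    next
      case 2 then show ?thesis using end_cont[of b] Sa zero by (simp add: b_def)
    next
      case 3 then show ?thesis using dF DERIV_isCont by blast
    qed
  qed
  then have "(f has_integral F b - F a) {a..b}"
    by (rule fundamental_theorem_of_calculus_interior[OF less_imp_le[OF ab]])
       (auto simp: has_real_derivative_iff_has_vector_derivative[symmetric] dF)
  then have F0: "(f has_integral 0) {a..b}" by (simp add: F_def Sa)
  have contr': "continuous_on {a..b} r" "continuous_on {a..b} r'"
    by (rule continuous_on_of_derivative[OF der], rule continuous_on_subset[OF cont]) simp
  have int: "((\<lambda>x. (r' x)\<^sup>2 - k\<^sup>2 * (r x)\<^sup>2) has_integral
       integral {a..b} (\<lambda>x. (r' x)\<^sup>2 - k\<^sup>2 * (r x)\<^sup>2)) {a..b}"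
    by (intro integrable_integral integrable_continuous_real continuous_intros contr')
  have le: "f x \<le> (r' x)\<^sup>2 - k\<^sup>2 * (r x)\<^sup>2" for x
  proof -
    have "(r' x)\<^sup>2 - k\<^sup>2 * (r x)\<^sup>2 - f x = (r' x - k * r x * (C x / S x))\<^sup>2"
      unfolding f_def by (simp add: algebra_simps power2_eq_square)
    then show ?thesis by (smt (verit) zero_le_power2)
  qed
  have "0 \<le> integral {a..b} (\<lambda>x. (r' x)\<^sup>2 - k\<^sup>2 * (r x)\<^sup>2)"
    by (rule has_integral_le[OF F0 int]) (rule le)
  then show ?thesis by (simp add: b_def)
qed

text \<open>
  The intermediate value theorem gives a point \<open>a\<close> with \<open>q(a) = q(a + P/2)\<close>.  Subtracting the common value
  \<open>m\<close> yields a function that vanishes at the ends of two adjacent intervals of length \<open>P/2\<close>, on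
  each of which \<open>wirtinger_dirichlet\<close> applies; since \<open>q\<close> has mean zero, passing from \<open>q - m\<close> back
  to \<open>q\<close> only decreases \<open>\<integral> q\<^sup>2\<close>.
\<close>

lemma wirtinger_periodic:
  fixes q q' :: "real \<Rightarrow> real"
  assumes der: "\<And>x. (q has_real_derivative q' x) (at x)" and cont: "continuous_on UNIV q'"
    and P: "0 < P" and per: "\<And>x. q (x + P) = q x" and mean: "integral {0..P} q = 0"
  shows "0 \<le> integral {0..P} (\<lambda>x. (q' x)\<^sup>2 - (2 * pi / P)\<^sup>2 * (q x)\<^sup>2)"
proof -
  have contq: "continuous_on UNIV q"
    by (rule continuous_on_of_derivative[OF der])
  have per': "q' (x + P) = q' x" for x by (rule derivative_periodic[OF der per])
  have "\<exists>a. 0 \<le> a \<and> a \<le> P/2 \<and> q a = q (a + P/2)"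
  proof -
    \<comment> \<open>Periodicity gives \<open>h(x + P/2) = - h(x)\<close>, so \<open>h\<close> changes sign on \<open>[0, P/2]\<close>.\<close>
    define h where "h x = q (x + P/2) - q x" for x
    have h: "h (P/2) = - h 0" using per[of 0] by (simp add: h_def)
    have hc: "continuous_on {0..P/2} h" unfolding h_def
      by (intro continuous_intros continuous_on_compose2[OF contq]) auto
    have "\<exists>x\<ge>0. x \<le> P/2 \<and> h x = 0"
    proof (cases "h 0 \<le> 0")
      case True then show ?thesis using IVT'[of h 0 0 "P/2"] hc P h by auto
    next
      case False then show ?thesis using IVT2'[of h "P/2" 0 0] hc P h by auto
    qed
    then show ?thesis by (force simp: h_def)
  qed
  then obtain a where a: "q a = q (a + P/2)" by blast
  define k where "k = 2 * pi / P"
  have k: "0 < k" "pi / k = P / 2" using P by (auto simp: k_def)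
  define m where "m = q a"
  define f where "f x = (q' x)\<^sup>2 - k\<^sup>2 * (q x - m)\<^sup>2" for x
  have cf: "continuous_on UNIV f" unfolding f_def by (intro continuous_intros contq cont)
  have d: "((\<lambda>x. q x - m) has_real_derivative q' x) (at x)" for x
    by (auto intro!: derivative_eq_intros der)
  have "0 \<le> integral {a..a + P/2} f"
    using wirtinger_dirichlet[OF d cont k(1), of a] a unfolding f_def k(2) by (simp add: m_def)
  moreover have "0 \<le> integral {a + P/2..a + P} f"
    using wirtinger_dirichlet[OF d cont k(1), of "a + P/2"] a per[of a]
    unfolding f_def k(2) by (simp add: m_def add.assoc)
  moreover have "integral {a..a + P/2} f + integral {a + P/2..a + P} f = integral {a..a + P} f"
    using P cf by (intro Henstock_Kurzweil_Integration.integral_combine integrable_continuous_real)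
      (auto intro: continuous_on_subset)
  moreover have "integral {a..a+P} f = integral {0..P} f"
    using integral_periodic_shift[OF cf, of P a 0] P by (simp add: f_def per per')
  ultimately have nonneg: "0 \<le> integral {0..P} f" by linarith
  have ig: "(q has_integral 0) {0..P}"
    using integrable_integral[OF integrable_continuous_real[OF continuous_on_subset[OF contq, of "{0..P}"]]] mean
    by simp
  have if': "(f has_integral integral {0..P} f) {0..P}"
    by (intro integrable_integral integrable_continuous_real continuous_on_subset[OF cf]) simp
  have "((\<lambda>x. f x - 2 * k\<^sup>2 * m * q x + k\<^sup>2 * m\<^sup>2) has_integral
      integral {0..P} f - 2 * k\<^sup>2 * m * 0 + (P - 0) *\<^sub>R (k\<^sup>2 * m\<^sup>2)) {0..P}"
    using P has_integral_const_real[of "k\<^sup>2 * m\<^sup>2" 0 P]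
    by (intro has_integral_add has_integral_diff has_integral_mult_right ig if') simp
  moreover have "(\<lambda>x. f x - 2 * k\<^sup>2 * m * q x + k\<^sup>2 * m\<^sup>2) = (\<lambda>x. (q' x)\<^sup>2 - k\<^sup>2 * (q x)\<^sup>2)"
    by (auto simp: f_def power2_diff algebra_simps power2_eq_square)
  ultimately have "integral {0..P} (\<lambda>x. (q' x)\<^sup>2 - k\<^sup>2 * (q x)\<^sup>2) = integral {0..P} f + P * (k\<^sup>2 * m\<^sup>2)"
    by (simp add: integral_unique)
  then show ?thesis using nonneg P by (simp add: k_def)
qed

text \<open>
  Equality holds for \<open>1 - (\<pi>/2) sin (x - a)\<close>: on \<open>[a, a + \<pi>]\<close> it solves the Euler--Lagrange equation
  \<open>y'' + y = const\<close>, has mean zero and takes the value \<open>1\<close> at both ends.  Removing \<open>q(a)\<close>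
  times this function from \<open>q\<close> leaves \<open>r\<close>, which vanishes at \<open>a\<close> and \<open>a + \<pi>\<close> and has mean zero.  The mixed terms then integrate to zero, the extremal
  part contributes \<open>\<pi> q(a)\<^sup>2\<close>, and \<open>\<integral> (r'\<^sup>2 - r\<^sup>2)\<close> is nonnegative.
\<close>

lemma mean_zero_pointwise_bound:
  fixes q q' :: "real \<Rightarrow> real"
  assumes der: "\<And>x. (q has_real_derivative q' x) (at x)" and cont: "continuous_on UNIV q'"
    and ends: "q (a + pi) = q a" and mean: "integral {a..a+pi} q = 0"
  shows "pi * (q a)\<^sup>2 \<le> integral {a..a+pi} (\<lambda>x. (q' x)\<^sup>2 - (q x)\<^sup>2)"
proof -
  define m h where "m = q a" and "h = m * pi / 2"
  have contq: "continuous_on UNIV q"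
    by (rule continuous_on_of_derivative[OF der])
  obtain Q where Q: "\<And>x. (Q has_real_derivative q x) (at x)"
    using antiderivative_exists[OF contq] by blast
  have Q0: "Q (a + pi) - Q a = 0"
    using has_integral_derivative[OF Q, of a "a+pi"] mean by (simp add: integral_unique)
  define r r' where "r x = q x - m + h * sin (x - a)" and "r' x = q' x + h * cos (x - a)" for x
  have dr: "(r has_real_derivative r' x) (at x)" for x
    unfolding r_def r'_def by (auto intro!: derivative_eq_intros der)
  have cr: "continuous_on UNIV r'" unfolding r'_def by (intro continuous_intros cont)
  have ra: "r a = 0" "r (a + pi) = 0" by (simp_all add: r_def m_def ends)
  have nonneg: "0 \<le> integral {a..a+pi} (\<lambda>x. (r' x)\<^sup>2 - (r x)\<^sup>2)"
    using wirtinger_dirichlet[OF dr cr, of 1 a] ra by simp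
  have cr2: "continuous_on UNIV r" unfolding r_def by (intro continuous_intros contq)
  \<comment> \<open>An antiderivative of the difference of the two integrands, which shows that the mixed terms
    only contribute boundary values.\<close>
  define H where "H x = h\<^sup>2 * (sin (x - a) * cos (x - a)) + m\<^sup>2 * x
      - 2 * h * (cos (x - a) * r x) - 2 * m * Q x" for x
  define g where "g x = (q' x)\<^sup>2 - (q x)\<^sup>2 - ((r' x)\<^sup>2 - (r x)\<^sup>2)" for x
  have "(H has_real_derivative g x) (at x)" for x
  proof -
    have gx: "g x = h\<^sup>2 * (cos (x - a) * cos (x - a) - sin (x - a) * sin (x - a)) + m\<^sup>2
        - 2 * h * (cos (x - a) * r' x - sin (x - a) * r x) - 2 * m * q x"
      unfolding g_def r_def r'_def by (simp add: power2_eq_square algebra_simps)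
    have cs: "((\<lambda>x. cos (x - a)) has_real_derivative - sin (x - a)) (at x)"
      "((\<lambda>x. sin (x - a)) has_real_derivative cos (x - a)) (at x)"
      by (auto intro!: derivative_eq_intros)
    note D = DERIV_diff[OF DERIV_diff[OF DERIV_add[OF DERIV_cmult[OF DERIV_mult[OF cs(2) cs(1)]]
      DERIV_cmult_Id] DERIV_cmult[OF DERIV_mult[OF cs(1) dr]]] DERIV_cmult[OF Q],
      of "h\<^sup>2" "m\<^sup>2" "2 * h" "2 * m"]
    show ?thesis unfolding H_def by (rule DERIV_cong[OF D]) (simp add: gx)
  qed
  from has_integral_derivative[OF this, of a "a+pi"]
  have "(g has_integral H (a + pi) - H a) {a..a+pi}" by simp
  moreover have "H (a + pi) - H a = pi * m\<^sup>2"
    using Q0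
    by (simp add: H_def ra distrib_left)
  moreover have "((\<lambda>x. (r' x)\<^sup>2 - (r x)\<^sup>2) has_integral
      integral {a..a+pi} (\<lambda>x. (r' x)\<^sup>2 - (r x)\<^sup>2)) {a..a+pi}"
    by (intro integrable_integral integrable_continuous_real continuous_intros
         continuous_on_subset[OF cr] continuous_on_subset[OF cr2]) simp_all
  ultimately have "((\<lambda>x. g x + ((r' x)\<^sup>2 - (r x)\<^sup>2)) has_integral
       pi * m\<^sup>2 + integral {a..a+pi} (\<lambda>x. (r' x)\<^sup>2 - (r x)\<^sup>2)) {a..a+pi}"
    by (intro has_integral_add) auto
  then have "integral {a..a+pi} (\<lambda>x. (q' x)\<^sup>2 - (q x)\<^sup>2)
      = pi * m\<^sup>2 + integral {a..a+pi} (\<lambda>x. (r' x)\<^sup>2 - (r x)\<^sup>2)"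
    by (simp add: g_def integral_unique)
  then show ?thesis using nonneg by (simp add: m_def)
qed

section \<open>The moving frame and the tangent angle\<close>

text \<open>
  The derivative of \<open>dir\<close>: the unit tangent, at a point with outer normal \<open>dir \<theta>\<close>, of a
  positively oriented curve.
\<close>

definition tdir :: "real \<Rightarrow> plane" where
  "tdir \<theta> = (- sin \<theta>, cos \<theta>)"

lemma dir_has_vector_derivative: "(dir has_vector_derivative tdir \<theta>) (at \<theta>)"
  unfolding dir_def[abs_def] tdir_def
  by (intro has_vector_derivative_Pair)
     (auto intro!: derivative_eq_intros simp flip: has_real_derivative_iff_has_vector_derivative)

lemma tdir_has_vector_derivative: "(tdir has_vector_derivative - dir \<theta>) (at \<theta>)"
  unfolding dir_def tdir_def[abs_def] uminus_Pair
  by (intro has_vector_derivative_Pair)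
     (auto intro!: derivative_eq_intros simp flip: has_real_derivative_iff_has_vector_derivative)

lemma inner_dir [simp]:
  "dir x \<bullet> dir y = cos (x - y)" "tdir x \<bullet> tdir y = cos (x - y)"
  "tdir x \<bullet> dir y = - sin (x - y)" "dir x \<bullet> tdir y = sin (x - y)"
  by (simp_all add: dir_def tdir_def inner_prod_def cos_diff sin_diff)

lemma frame_decomposition: "v = (v \<bullet> dir \<theta>) *\<^sub>R dir \<theta> + (v \<bullet> tdir \<theta>) *\<^sub>R tdir \<theta>"
proof -
  have "cos \<theta> * cos \<theta> + sin \<theta> * sin \<theta> = 1"
    using sin_cos_squared_add2[of \<theta>] by (simp add: power2_eq_square)
  then have "fst v = (fst v * cos \<theta> + snd v * sin \<theta>) * cos \<theta> - (snd v * cos \<theta> - fst v * sin \<theta>) * sin \<theta>"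
    "snd v = (fst v * cos \<theta> + snd v * sin \<theta>) * sin \<theta> + (snd v * cos \<theta> - fst v * sin \<theta>) * cos \<theta>"
    by algebra+
  then show ?thesis by (simp add: prod_eq_iff dir_def tdir_def inner_prod_def)
qed

lemma has_real_derivative_inner:
  fixes f g :: "real \<Rightarrow> 'a::real_inner"
  assumes "(f has_vector_derivative f') (at x)" "(g has_vector_derivative g') (at x)"
  shows "((\<lambda>x. f x \<bullet> g x) has_real_derivative f x \<bullet> g' + f' \<bullet> g x) (at x)"
  using bounded_bilinear.has_vector_derivative[OF bounded_bilinear_inner assms]
  by (simp add: has_real_derivative_iff_has_vector_derivative)

lemma smooth_curve_derivatives:
  assumes "smooth_curve c"
  shows "(c has_vector_derivative vel c t) (at t)"
    "(vel c has_vector_derivative vel (vel c) t) (at t)"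
    "continuous_on UNIV (vel c)" "continuous_on UNIV (vel (vel c))"
proof -
  have d: "(vel ^^ n) c differentiable at t" for n t
    using assms by (simp add: smooth_curve_def)
  show "(c has_vector_derivative vel c t) (at t)"
    using d[of 0 t] by (simp add: vel_def vector_derivative_works)
  show "(vel c has_vector_derivative vel (vel c) t) (at t)"
    using d[of 1 t] by (simp add: vel_def[of "vel c"] vector_derivative_works)
  show "continuous_on UNIV (vel c)" "continuous_on UNIV (vel (vel c))"
    using d[of 1] d[of 2]
    by (auto intro!: continuous_at_imp_continuous_on differentiable_imp_continuous_within
        simp: numeral_2_eq_2)
qed

lemma vel_periodic:
  assumes der: "\<And>t. (c has_vector_derivative vel c t) (at t)" and per: "\<And>t. c (t + T) = c t"
  shows "vel c (t + T) = vel c t"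
proof -
  have "((\<lambda>t. t + T) has_vector_derivative 1) (at t)"
    by (auto intro!: derivative_eq_intros)
  from vector_diff_chain_at[OF this der]
  have "(c has_vector_derivative vel c (t + T)) (at t)" by (simp add: o_def per)
  then show ?thesis using der[of t] vector_derivative_unique_at by blast
qed

text \<open>
  The number \<open>det2 v v' / \<bar>v\<bar>\<^sup>2\<close> is the angular velocity of \<open>v\<close>.  A frame rotating at this
  speed therefore sees \<open>v\<close> in a fixed direction.
\<close>

lemma constant_angle_to_rotating_frame:
  fixes v v' :: "real \<Rightarrow> plane"
  assumes dv: "\<And>t. (v has_vector_derivative v' t) (at t)" and nz: "\<And>t. v t \<noteq> 0"
    and dB: "\<And>t. (\<beta> has_real_derivative det2 (v t) (v' t) / (norm (v t))\<^sup>2) (at t)"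
  shows "(v s \<bullet> dir (\<beta> s)) / norm (v s) = (v t \<bullet> dir (\<beta> t)) / norm (v t)"
proof -
  define N where "N t = norm (v t)" for t
  have Npos: "0 < N t" for t using nz by (simp add: N_def)
  have N2: "v t \<bullet> v t = (N t)\<^sup>2" for t by (simp add: N_def power2_norm_eq_inner)
  have dN: "(N has_real_derivative (v t \<bullet> v' t) / N t) (at t)" for t
  proof -
    have "N = (\<lambda>t. sqrt (v t \<bullet> v t))" by (simp add: N_def[abs_def] norm_eq_sqrt_inner)
    moreover have "((\<lambda>t. sqrt (v t \<bullet> v t)) has_real_derivative
        (v t \<bullet> v' t + v' t \<bullet> v t) * (inverse (sqrt (v t \<bullet> v t)) / 2)) (at t)"
      using DERIV_chain2[OF DERIV_real_sqrt has_real_derivative_inner[OF dv dv], of t] nz[of t]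
      by (simp add: mult.commute)
    ultimately show ?thesis using Npos[of t]
      by (simp add: inner_commute N2 field_simps)
  qed
  have ddir: "((\<lambda>t. dir (\<beta> t)) has_vector_derivative
      (det2 (v t) (v' t) / (N t)\<^sup>2) *\<^sub>R tdir (\<beta> t)) (at t)" for t
    using vector_diff_chain_at[OF dB[unfolded has_real_derivative_iff_has_vector_derivative]
        dir_has_vector_derivative] by (simp add: o_def N_def)
  have "((\<lambda>t. (v t \<bullet> dir (\<beta> t)) / N t) has_real_derivative 0) (at t)" for t
  proof -
    have ne: "N t \<noteq> 0" using Npos[of t] by simp
    have "(v t \<bullet> tdir (\<beta> t)) * det2 (v t) (v' t) + (v' t \<bullet> dir (\<beta> t)) * (v t \<bullet> v t)
        - (v t \<bullet> dir (\<beta> t)) * (v t \<bullet> v' t) = 0"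
      by (simp add: dir_def tdir_def inner_prod_def det2_def algebra_simps)
    then have z: "((v t \<bullet> ((det2 (v t) (v' t) / (N t)\<^sup>2) *\<^sub>R tdir (\<beta> t)) + v' t \<bullet> dir (\<beta> t)) * N t
        - (v t \<bullet> dir (\<beta> t)) * ((v t \<bullet> v' t) / N t)) / (N t * N t) = 0"
      using ne unfolding N2 by (simp add: field_simps power2_eq_square)
    show ?thesis
      using DERIV_divide[OF has_real_derivative_inner[OF dv ddir] dN ne] unfolding z .
  qed
  from DERIV_isconst_all[of "\<lambda>t. (v t \<bullet> dir (\<beta> t)) / N t", OF allI, OF this]
  show ?thesis by (simp add: N_def)
qed

text \<open>
  The angle is obtained by integrating the angular velocity from a suitable initial angle.  The
  components of \<open>v / \<bar>v\<bar>\<close> in the frame that it drives are constant, so they keep their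
  initial values \<open>0\<close> and \<open>1\<close>.
\<close>

lemma tangent_angle_exists:
  fixes v v' :: "real \<Rightarrow> plane"
  assumes dv: "\<And>t. (v has_vector_derivative v' t) (at t)" and cont: "continuous_on UNIV v'"
    and nz: "\<And>t. v t \<noteq> 0"
  obtains \<beta> where "\<And>t. (\<beta> has_real_derivative det2 (v t) (v' t) / (norm (v t))\<^sup>2) (at t)"
    and "\<And>t. v t = norm (v t) *\<^sub>R tdir (\<beta> t)"
proof -
  have cv: "continuous_on UNIV v"
    using dv has_vector_derivative_continuous continuous_at_imp_continuous_on by blast
  have "continuous_on UNIV (\<lambda>t. det2 (v t) (v' t) / (norm (v t))\<^sup>2)"
    unfolding det2_def using nz by (intro continuous_intros cv cont) auto
  from antiderivative_exists[OF this] obtain F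
    where F: "\<And>t. (F has_real_derivative det2 (v t) (v' t) / (norm (v t))\<^sup>2) (at t)" by blast
  define u where "u = (1 / norm (v 0)) *\<^sub>R v 0"
  have u: "v 0 = norm (v 0) *\<^sub>R u" using nz by (simp add: u_def)
  have "norm u = 1" using nz by (simp add: u_def)
  then have "(snd u)\<^sup>2 + (- fst u)\<^sup>2 = 1"
    by (simp add: norm_prod_def real_sqrt_eq_1_iff add.commute)
  then obtain \<theta> where th: "snd u = cos \<theta>" "- fst u = sin \<theta>" by (rule sincos_total_2pi)
  then have ut: "u = tdir \<theta>" by (simp add: tdir_def prod_eq_iff)
  define \<beta> where "\<beta> t = F t + (\<theta> - F 0)" for t
  have dB: "(\<beta> has_real_derivative det2 (v t) (v' t) / (norm (v t))\<^sup>2) (at t)" for t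
    unfolding \<beta>_def by (auto intro!: derivative_eq_intros F)
  \<comment> \<open>The other vector of the frame is \<open>dir\<close> advanced by a right angle, so that both components
    come from the same lemma.\<close>
  have dB': "((\<lambda>t. \<beta> t + pi / 2) has_real_derivative det2 (v t) (v' t) / (norm (v t))\<^sup>2) (at t)" for t
    by (auto intro!: derivative_eq_intros dB)
  have quarter: "dir (x + pi/2) = tdir x" for x
    by (simp add: dir_def tdir_def cos_add sin_add)
  have v0: "v 0 \<bullet> dir (\<beta> 0) = 0" "v 0 \<bullet> tdir (\<beta> 0) = norm (v 0)"
    by (subst u, simp add: ut \<beta>_def)+
  have "v t = norm (v t) *\<^sub>R tdir (\<beta> t)" for t
  proof -
    have "v t \<bullet> dir (\<beta> t) = 0"
      using constant_angle_to_rotating_frame[OF dv nz dB, of t 0] nz by (simp add: v0)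
    moreover have "v t \<bullet> tdir (\<beta> t) = norm (v t)"
      using constant_angle_to_rotating_frame[OF dv nz dB', of t 0] nz[of t] nz[of 0]
      by (simp add: v0 quarter)
    ultimately show ?thesis using frame_decomposition[of "v t" "\<beta> t"] by simp
  qed
  with dB show ?thesis using that by blast
qed

section \<open>Supporting lines of strictly convex sets\<close>

lemma strictly_convex_closure: "strictly_convex K \<Longrightarrow> convex (closure K)"
  unfolding convex_contains_open_segment strictly_convex_def
proof (intro ballI)
  fix x y assume K: "\<forall>x\<in>closure K. \<forall>y\<in>closure K. x \<noteq> y \<longrightarrow> open_segment x y \<subseteq> interior K"
    and xy: "x \<in> closure K" "y \<in> closure K"
  have "interior K \<subseteq> closure K" using interior_subset closure_subset by blast
  then show "open_segment x y \<subseteq> closure K"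
    using K xy by (cases "x = y") (simp, blast)
qed

text \<open>
  A segment that starts in the interior of \<open>K\<close> and ends at an interior point \<open>x\<close> of the closure can
  be prolonged slightly beyond \<open>x\<close>; strict convexity puts its open part, and with it \<open>x\<close>, into the
  interior of \<open>K\<close>.  Hence frontier points of \<open>K\<close> are boundary points of a convex set and have
  supporting lines.
\<close>

lemma strictly_convex_interior_closure:
  assumes K: "strictly_convex K" and ne: "interior K \<noteq> {}"
  shows "interior (closure K) = interior K"
proof
  show "interior K \<subseteq> interior (closure K)" by (simp add: closure_subset interior_mono)
  show "interior (closure K) \<subseteq> interior K"
  proof
    fix x assume x: "x \<in> interior (closure K)"
    obtain y where y: "y \<in> interior K" using ne by blast
    show "x \<in> interior K"
    proof (cases "x = y")
      case False
      obtain e where e: "0 < e" "cball x e \<subseteq> closure K" using x mem_interior_cball by blast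
      define d where "d = e / norm (x - y)"
      have d: "0 < d" using False e by (simp add: d_def)
      define z where "z = x + d *\<^sub>R (x - y)"
      have "z \<in> cball x e" using False e by (simp add: z_def d_def dist_norm)
      then have z: "z \<in> closure K" using e by blast
      have "z - y = (1 + d) *\<^sub>R (x - y)" by (simp add: z_def algebra_simps)
      then have zy: "y \<noteq> z" using False d by auto
      have "x = (1 - 1/(1+d)) *\<^sub>R y + (1/(1+d)) *\<^sub>R z"
      proof -
        have "(1 - 1/(1+d)) *\<^sub>R y + (1/(1+d)) *\<^sub>R z = y + (1/(1+d)) *\<^sub>R (z - y)"
          by (simp add: algebra_simps)
        also have "\<dots> = y + (x - y)" unfolding \<open>z - y = _\<close> using d by simp
        finally show ?thesis by simp
      qed
      then have "x \<in> open_segment y z" using zy d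
        unfolding in_segment by (intro conjI exI[of _ "1/(1+d)"]) (auto simp: field_simps)
      moreover have "y \<in> closure K" using y interior_subset closure_subset by blast
      ultimately show ?thesis using K z zy unfolding strictly_convex_def by blast
    qed (use y in simp)
  qed
qed

lemma strictly_convex_supporting_line:
  assumes "strictly_convex K" "interior K \<noteq> {}" "x \<in> frontier K"
  obtains a where "a \<noteq> 0" "\<And>y. y \<in> frontier K \<Longrightarrow> a \<bullet> x \<le> a \<bullet> y"
proof -
  have "interior (closure K) \<noteq> {}" using assms strictly_convex_interior_closure by metis
  then have "x \<notin> rel_interior (closure K)"
    using assms by (simp add: rel_interior_nonempty_interior strictly_convex_interior_closure frontier_def)
  moreover have "x \<in> closure K" using assms(3) by (simp add: frontier_def)
  ultimately obtain a where "a \<noteq> 0" "\<And>y. y \<in> closure K \<Longrightarrow> a \<bullet> x \<le> a \<bullet> y"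
    using supporting_hyperplane_rel_boundary[OF strictly_convex_closure[OF assms(1)]] by metis
  then show ?thesis using that by (simp add: frontier_def)
qed

text \<open>
  A supporting line at \<open>c t\<close> has to be the tangent, so only its side is in question.  Were the curve
  on the other side, \<open>c t\<close> would minimise \<open>c \<bullet> dir (\<beta> t)\<close>; but this function decreases as the
  tangent angle grows from \<open>\<beta> t\<close> by up to a quarter turn.
\<close>

lemma support_at_tangent:
  fixes c :: "real \<Rightarrow> plane"
  assumes K: "strictly_convex K" "interior K \<noteq> {}" and fr: "frontier K = range c"
    and dc: "\<And>t. (c has_vector_derivative c' t) (at t)" and nz: "\<And>t. c' t \<noteq> 0"
    and angle: "\<And>t. c' t = norm (c' t) *\<^sub>R tdir (\<beta> t)"
    and mono: "strict_mono \<beta>" and surj: "surj \<beta>"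
  shows "c s \<bullet> dir (\<beta> t) \<le> c t \<bullet> dir (\<beta> t)"
proof -
  define g where "g s = c s \<bullet> dir (\<beta> t)" for s
  have dg: "(g has_real_derivative c' s \<bullet> dir (\<beta> t)) (at s)" for s
    unfolding g_def using has_real_derivative_inner[OF dc has_vector_derivative_const] by simp
  have cfr: "c s \<in> frontier K" for s unfolding fr by simp
  obtain a where a: "a \<noteq> 0" "\<And>s. a \<bullet> c t \<le> a \<bullet> c s"
    using strictly_convex_supporting_line[OF K cfr[of t]] cfr by metis
  have "((\<lambda>s. a \<bullet> c s) has_real_derivative a \<bullet> c' t) (at t)"
    using has_real_derivative_inner[OF has_vector_derivative_const dc] by simp
  then have "a \<bullet> c' t = 0"
    using DERIV_local_min[of _ "a \<bullet> c' t" t 1] a by simp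
  then have "a \<bullet> tdir (\<beta> t) = 0" using nz[of t] by (subst (asm) angle) simp
  then have a_dir: "a = (a \<bullet> dir (\<beta> t)) *\<^sub>R dir (\<beta> t)" using frame_decomposition[of a "\<beta> t"] by simp
  define l where "l = a \<bullet> dir (\<beta> t)"
  have al: "a = l *\<^sub>R dir (\<beta> t)" using a_dir by (simp add: l_def)
  have l0: "l \<noteq> 0" using al a by auto
  have ineq: "l * g t \<le> l * g s" for s using a(2)[of s] unfolding al g_def by (simp add: inner_commute)
  \<comment> \<open>The coefficient \<open>l\<close> is negative because the vector \<open>a\<close> points to the inner side.\<close>
  have "l < 0"
  proof (rule ccontr)
    assume "\<not> l < 0"
    then have min: "g t \<le> g s" for s using ineq[of s] l0 by simp
    obtain u where u: "\<beta> u = \<beta> t + pi / 2" using surj by (metis surjD)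
    have tu: "t < u" using u mono pi_gt_zero
      by (metis less_add_same_cancel1 half_gt_zero strict_mono_less)
    have "g u < g t"
    proof (rule DERIV_neg_imp_decreasing_open[OF tu])
      fix x assume x: "t < x" "x < u"
      then have "\<beta> t < \<beta> x" "\<beta> x < \<beta> t + pi/2" using mono u by (metis strict_mono_less)+
      then have "0 < sin (\<beta> x - \<beta> t)" by (intro sin_gt_zero) (auto simp: pi_gt_zero)
      moreover have "c' x \<bullet> dir (\<beta> t) = norm (c' x) * (- sin (\<beta> x - \<beta> t))"
        by (subst angle) simp
      ultimately have "c' x \<bullet> dir (\<beta> t) < 0" using nz[of x] by (simp add: mult_pos_neg)
      then show "\<exists>y. DERIV g x :> y \<and> y < 0" using dg by blast
    next
      show "continuous_on {t..u} g" by (rule continuous_on_of_derivative[OF dg])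
    qed
    then show False using min[of u] by simp
  qed
  then show ?thesis using ineq[of s] by (simp add: g_def)
qed

section \<open>The support function of an oval\<close>

lemma support_fun_eq_maximum:
  assumes "x \<in> M" "\<And>y. y \<in> M \<Longrightarrow> y \<bullet> dir \<theta> \<le> x \<bullet> dir \<theta>"
  shows "support_fun M \<theta> = x \<bullet> dir \<theta>"
  unfolding support_fun_def using assms by (intro cSup_eq_maximum) auto

lemma support_fun_periodic: "support_fun M (\<theta> + 2 * pi) = support_fun M \<theta>"
  by (simp add: support_fun_def dir_def)

text \<open>
  Let \<open>\<tau>\<close> be the inverse of the tangent angle.  From \<open>p(x) = c(\<tau>(x)) \<bullet> dir x\<close> and the fact that
  \<open>c' \<circ> \<tau>\<close> is orthogonal to \<open>dir\<close>, one gets \<open>p' = (c \<circ> \<tau>) \<bullet> tdir\<close> and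
  \<open>p + p'' = \<bar>c' \<circ> \<tau>\<bar> \<tau>'\<close>.  The last expression is the derivative of the arc length of \<open>c\<close> up to
  \<open>\<tau>(x)\<close>, so \<open>\<integral> p\<close> over a full turn is the length, provided that the tangent turns exactly once while
  \<open>c\<close> is traversed once.  This is where injectivity of \<open>c\<close> enters: the formulas for \<open>p\<close> and \<open>p'\<close>
  determine \<open>c(\<tau>(x))\<close> from \<open>x\<close> modulo \<open>2\<pi>\<close>, and equal points belong to equal parameters modulo the
  period.
\<close>

lemma oval_support_function:
  fixes K :: "plane set" and c :: "real \<Rightarrow> plane"
  assumes K: "strictly_convex K" "interior K \<noteq> {}"
    and oval: "oval c T" and fr: "frontier K = c ` {0..T}"
  defines "p \<equiv> support_fun (frontier K)"
  obtains p' p'' where "\<And>x. (p has_real_derivative p' x) (at x)"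
    and "\<And>x. (p' has_real_derivative p'' x) (at x)"
    and "continuous_on UNIV p''"
    and "integral {0..2*pi} p = curve_length c T"
proof -
  have T: "0 < T" and smooth: "smooth_curve c" and per: "\<And>t. c (t + T) = c t"
    and inj: "inj_on c {0..<T}" and nz: "\<And>t. vel c t \<noteq> 0"
    and curv: "\<And>t. 0 < signed_curvature c t"
    using oval by (auto simp: oval_def)
  note dc = smooth_curve_derivatives[OF smooth]
  have vper: "vel c (t + T) = vel c t" for t by (rule vel_periodic[OF dc(1) per])
  have vper2: "vel (vel c) (t + T) = vel (vel c) t" for t by (rule vel_periodic[OF dc(2) vper])
  define s where "s t = norm (vel c t)" for t
  define \<omega> where "\<omega> t = det2 (vel c t) (vel (vel c) t) / (s t)\<^sup>2" for t
  have spos: "0 < s t" for t using nz by (simp add: s_def)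
  have wpos: "0 < \<omega> t" for t
    using curv[of t] spos[of t] unfolding signed_curvature_def \<omega>_def s_def[symmetric]
    by (simp add: zero_less_divide_iff)
  have cs: "continuous_on UNIV s" unfolding s_def by (intro continuous_intros dc)
  have cw: "continuous_on UNIV \<omega>" unfolding \<omega>_def det2_def
    using spos by (intro continuous_intros dc cs) (auto simp: less_imp_neq[symmetric])
  obtain \<beta> where dB: "\<And>t. (\<beta> has_real_derivative \<omega> t) (at t)"
    and angle: "\<And>t. vel c t = s t *\<^sub>R tdir (\<beta> t)"
    using tangent_angle_exists[OF dc(2) dc(4) nz] unfolding \<omega>_def s_def by blast
  define D where "D = \<beta> T - \<beta> 0"
  have shift: "\<beta> (t + T) = \<beta> t + D" for t
  proof -
    have "((\<lambda>x. \<beta> (x + T) - \<beta> x) has_real_derivative \<omega> (x + T) - \<omega> x) (at x)" for x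
      using DERIV_diff[OF DERIV_shift[THEN iffD1, OF dB] dB] .
    moreover have "\<omega> (x + T) - \<omega> x = 0" for x by (simp add: \<omega>_def s_def vper vper2)
    ultimately have "((\<lambda>x. \<beta> (x + T) - \<beta> x) has_real_derivative 0) (at x)" for x by simp
    from DERIV_isconst_all[of "\<lambda>x. \<beta> (x + T) - \<beta> x" t 0, OF allI, OF this]
    show ?thesis by (simp add: D_def)
  qed
  have mono: "strict_mono \<beta>" and surj: "surj \<beta>"
    using lift_of_circle_map_bij[OF dB wpos T shift] by auto
  have D: "0 < D" using strict_monoD[OF mono, of 0 T] T by (simp add: D_def)
  define \<tau> where "\<tau> = inv \<beta>"
  have \<beta>\<tau>: "\<beta> (\<tau> x) = x" for x unfolding \<tau>_def by (rule surj_f_inv_f[OF surj])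
  have \<tau>\<beta>: "\<tau> (\<beta> t) = t" for t unfolding \<tau>_def by (simp add: strict_mono_imp_inj_on[OF mono])
  have d\<tau>: "(\<tau> has_real_derivative 1 / \<omega> (\<tau> x)) (at x)" for x
    unfolding \<tau>_def by (rule DERIV_inv_strict_mono[OF dB wpos mono surj])
  have c\<tau>: "continuous_on UNIV \<tau>"
    by (rule continuous_on_of_derivative[OF d\<tau>])

  have fr': "frontier K = range c"
  proof
    show "range c \<subseteq> frontier K"
    proof
      fix x assume "x \<in> range c"
      then obtain t where t: "x = c t" by blast
      obtain n :: int where "0 \<le> t + of_int n * T" "t + of_int n * T < T" "c (t + of_int n * T) = c t"
        using periodic_representative[where f = c, OF per T] by blast
      then show "x \<in> frontier K" unfolding fr t
        by (intro image_eqI[of _ _ "t + of_int n * T"]) auto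
    qed
  qed (auto simp: fr)
  have p_eq: "p x = c (\<tau> x) \<bullet> dir x" for x
  proof -
    have "c u \<bullet> dir x \<le> c (\<tau> x) \<bullet> dir x" for u
      using support_at_tangent[OF K fr' dc(1) nz angle[unfolded s_def] mono surj, of u "\<tau> x"]
      by (simp add: \<beta>\<tau>)
    then show ?thesis unfolding p_def fr' by (intro support_fun_eq_maximum) auto
  qed
  define p' where "p' x = c (\<tau> x) \<bullet> tdir x" for x
  define p'' where "p'' x = s (\<tau> x) / \<omega> (\<tau> x) - p x" for x
  have dc\<tau>: "((\<lambda>x. c (\<tau> x)) has_vector_derivative (s (\<tau> x) / \<omega> (\<tau> x)) *\<^sub>R tdir x) (at x)" for x
    using vector_diff_chain_at[OF d\<tau>[unfolded has_real_derivative_iff_has_vector_derivative] dc(1), of x]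
    by (simp add: o_def angle \<beta>\<tau>)
  have dp: "(p has_real_derivative p' x) (at x)" for x
  proof -
    have "p = (\<lambda>x. c (\<tau> x) \<bullet> dir x)" using p_eq by blast
    then show ?thesis
      using has_real_derivative_inner[OF dc\<tau> dir_has_vector_derivative, of x] by (simp add: p'_def)
  qed
  have dp': "(p' has_real_derivative p'' x) (at x)" for x
    using has_real_derivative_inner[OF dc\<tau> tdir_has_vector_derivative, of x]
    unfolding p'_def[abs_def] by (simp add: p''_def p_eq)
  have cp: "continuous_on UNIV p"
    by (rule continuous_on_of_derivative[OF dp])
  have cp'': "continuous_on UNIV p''" unfolding p''_def
    using wpos by (intro continuous_intros cp continuous_on_compose2[OF cs c\<tau>]
        continuous_on_compose2[OF cw c\<tau>]) (auto simp: less_imp_neq[symmetric])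
  have pper: "p (x + 2 * pi) = p x" for x by (simp add: p_def support_fun_periodic)
  have p'per: "p' (x + 2 * pi) = p' x" for x by (rule derivative_periodic[OF dp pper])

  have c\<tau>per: "c (\<tau> (x + 2 * pi)) = c (\<tau> x)" for x
  proof -
    have "c (\<tau> x) = p x *\<^sub>R dir x + p' x *\<^sub>R tdir x" for x
      using frame_decomposition[of "c (\<tau> x)" x] by (simp add: p_eq p'_def)
    moreover have "dir (x + 2 * pi) = dir x" "tdir (x + 2 * pi) = tdir x"
      by (simp_all add: dir_def tdir_def)
    ultimately show ?thesis by (simp add: pper p'per)
  qed
  \<comment> \<open>The tangent turns once per period: at most once, since after one turn the point \<open>c\<close> recurs and
    therefore a whole number of periods has elapsed; at least once, since the tangent recurs after
    a period.\<close>
  have D2pi: "D = 2 * pi"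
  proof (rule antisym)
    obtain n :: int where n: "0 \<le> \<tau> (2*pi) + of_int n * T" "\<tau> (2*pi) + of_int n * T < T"
      "c (\<tau> (2*pi) + of_int n * T) = c (\<tau> (2*pi))"
      using periodic_representative[where f = c, OF per T] by blast
    obtain m :: int where m: "0 \<le> \<tau> 0 + of_int m * T" "\<tau> 0 + of_int m * T < T"
      "c (\<tau> 0 + of_int m * T) = c (\<tau> 0)"
      using periodic_representative[where f = c, OF per T] by blast
    have "\<tau> (2*pi) + of_int n * T = \<tau> 0 + of_int m * T"
      using inj_onD[OF inj, of "\<tau> (2*pi) + of_int n * T" "\<tau> 0 + of_int m * T"] n m c\<tau>per[of 0] by simp
    then have eq: "\<tau> (2*pi) = \<tau> 0 + of_int (m - n) * T" by (simp add: algebra_simps)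
    moreover have "\<tau> 0 < \<tau> (2*pi)"
      using strict_mono_less[OF mono, of "\<tau> 0" "\<tau> (2*pi)"] by (simp add: \<beta>\<tau>)
    ultimately have "0 < of_int (m - n) * T" by simp
    then have "1 \<le> m - n" using T by (simp add: zero_less_mult_iff)
    then have "1 * T \<le> of_int (m - n) * T" using T by (intro mult_right_mono) auto
    then have "\<beta> (\<tau> 0 + T) \<le> \<beta> (\<tau> (2*pi))" unfolding strict_mono_less_eq[OF mono] eq by simp
    then show "D \<le> 2 * pi" by (simp add: shift \<beta>\<tau>)
  next
    have "s T = s 0" "vel c T = vel c 0" using vper[of 0] by (simp_all add: s_def)
    then have "tdir (\<beta> T) = tdir (\<beta> 0)" using angle[of T] angle[of 0] spos[of 0] by simp
    then have "tdir (\<beta> T) \<bullet> tdir (\<beta> 0) = tdir (\<beta> 0) \<bullet> tdir (\<beta> 0)" by simp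
    then have "cos D = 1" by (simp add: D_def)
    then obtain j :: int where j: "D = of_int j * 2 * pi" using cos_one_2pi_int by blast
    then have "1 \<le> j" using D by (simp add: zero_less_mult_iff)
    then have "1 * (2 * pi) \<le> of_int j * (2 * pi)" by (intro mult_right_mono) auto
    then show "2 * pi \<le> D" by (simp add: j)
  qed
  have \<tau>2pi: "\<tau> (2*pi) = \<tau> 0 + T"
    using \<tau>\<beta>[of "\<tau> 0 + T"] by (simp add: shift \<beta>\<tau> D2pi)

  obtain S where dS: "\<And>x. (S has_real_derivative s x) (at x)"
    using antiderivative_exists[OF cs] by blast
  have "integral {\<tau> 0..\<tau> 0 + T} s = integral {0..0 + T} s"
    using T by (intro integral_periodic_shift[OF cs]) (auto simp: s_def vper)
  then have L: "curve_length c T = S (\<tau> (2*pi)) - S (\<tau> 0)"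
    using has_integral_derivative[OF dS, of "\<tau> 0" "\<tau> 0 + T"] T
    by (simp add: curve_length_def s_def[symmetric] \<tau>2pi integral_unique)
  have "((\<lambda>x. S (\<tau> x) - p' x) has_real_derivative p x) (at x)" for x
    using DERIV_diff[OF DERIV_chain2[OF dS d\<tau>] dp', of x] by (simp add: p''_def)
  from has_integral_derivative[OF this, of 0 "2*pi"] p'per[of 0]
  have "integral {0..2*pi} p = curve_length c T" by (simp add: L integral_unique)
  then show ?thesis using that[OF dp dp' cp''] by blast
qed

section \<open>Curves with a given support function\<close>

lemma support_curve_frame: "support_curve p \<theta> = p \<theta> *\<^sub>R dir \<theta> + deriv p \<theta> *\<^sub>R tdir \<theta>"
  by (simp add: support_curve_def dir_def tdir_def)

lemma support_curve_has_vector_derivative: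
  assumes dp: "\<And>x. (p has_real_derivative p' x) (at x)"
    and dp': "\<And>x. (p' has_real_derivative p'' x) (at x)"
  shows "(support_curve p has_vector_derivative (p x + p'' x) *\<^sub>R tdir x) (at x)"
proof -
  have "deriv p = p'" using DERIV_imp_deriv[OF dp] by blast
  then have sc: "support_curve p = (\<lambda>x. p x *\<^sub>R dir x + p' x *\<^sub>R tdir x)"
    using support_curve_frame by (auto simp: fun_eq_iff)
  show ?thesis unfolding sc
    using has_vector_derivative_add[OF
        has_vector_derivative_scaleR[OF dp dir_has_vector_derivative]
        has_vector_derivative_scaleR[OF dp' tdir_has_vector_derivative], of x]
    by (simp add: algebra_simps)
qed

text \<open>
  The velocity is \<open>(p + p'') tdir\<close>, so the integrand of the area is \<open>p (p + p'')\<close>, and integration by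
  parts over a period turns \<open>p p''\<close> into \<open>- p'\<^sup>2\<close>.
\<close>

lemma oriented_area_support_curve:
  assumes dp: "\<And>x. (p has_real_derivative p' x) (at x)"
    and dp': "\<And>x. (p' has_real_derivative p'' x) (at x)"
    and per: "\<And>x. p (x + 2 * pi) = p x"
  shows "oriented_area (support_curve p) (2 * pi) = 1/2 * integral {0..2*pi} (\<lambda>x. (p x)\<^sup>2 - (p' x)\<^sup>2)"
proof -
  have vel: "vel (support_curve p) x = (p x + p'' x) *\<^sub>R tdir x" for x
    unfolding vel_def using support_curve_has_vector_derivative[OF dp dp'] by (rule vector_derivative_at)
  have one: "(cos x)\<^sup>2 + (sin x)\<^sup>2 = 1" for x :: real by simp
  have integrand: "- snd (support_curve p x) * fst (vel (support_curve p) x)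
      + fst (support_curve p x) * snd (vel (support_curve p) x) = p x * (p x + p'' x)" for x
  proof -
    have "- snd (support_curve p x) * fst (vel (support_curve p) x)
      + fst (support_curve p x) * snd (vel (support_curve p) x)
      = p x * (p x + p'' x) * ((cos x)\<^sup>2 + (sin x)\<^sup>2)"
      unfolding vel support_curve_def tdir_def by (simp add: algebra_simps power2_eq_square
          del: sin_cos_squared_add sin_cos_squared_add2 sin_cos_squared_add3)
    then show ?thesis by (simp only: one mult_1_right)
  qed
  have cp: "continuous_on UNIV p" "continuous_on UNIV p'"
    by (rule continuous_on_of_derivative, rule dp dp')+
  have p'per: "p' (x + 2 * pi) = p' x" for x by (rule derivative_periodic[OF dp per])
  have i1: "((\<lambda>x. (p x)\<^sup>2 - (p' x)\<^sup>2) has_integral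
      integral {0..2*pi} (\<lambda>x. (p x)\<^sup>2 - (p' x)\<^sup>2)) {0..2*pi}"
    by (intro integrable_integral integrable_continuous_real continuous_intros
        continuous_on_subset[OF cp(1)] continuous_on_subset[OF cp(2)]) simp_all
  have i2: "((\<lambda>x. p' x * p' x + p'' x * p x) has_integral 0) {0..2*pi}"
    using has_integral_derivative[OF DERIV_mult[OF dp dp'], of 0 "2*pi"] per[of 0] p'per[of 0] by simp
  have "((\<lambda>x. p x * (p x + p'' x)) has_integral
      integral {0..2*pi} (\<lambda>x. (p x)\<^sup>2 - (p' x)\<^sup>2)) {0..2*pi}"
    using has_integral_add[OF i1 i2] by (simp add: power2_eq_square algebra_simps)
  then show ?thesis unfolding oriented_area_def integrand by (simp add: integral_unique)
qed

text \<open>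
  The derivative of \<open>support_curve p x \<bullet> dir \<theta>\<close> in \<open>x\<close> is \<open>(p + p'') sin (\<theta> - x)\<close>.  Thus on the
  period centred at \<open>\<theta>\<close> this function increases up to \<open>\<theta>\<close> and decreases afterwards, and its value
  at \<open>\<theta>\<close> is \<open>p \<theta>\<close>.
\<close>

lemma support_fun_support_curve:
  assumes dp: "\<And>x. (p has_real_derivative p' x) (at x)"
    and dp': "\<And>x. (p' has_real_derivative p'' x) (at x)"
    and per: "\<And>x. p (x + 2 * pi) = p x"
    and pos: "\<And>x. 0 < p x + p'' x"
  shows "support_fun (support_curve p ` {0..2*pi}) \<theta> = p \<theta>"
proof -
  have dcurve: "deriv p = p'" using DERIV_imp_deriv[OF dp] by blast
  have cper: "support_curve p (x + 2 * pi) = support_curve p x" for x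
    using derivative_periodic[OF dp per] by (simp add: support_curve_def dcurve per)
  define f where "f x = support_curve p x \<bullet> dir \<theta>" for x
  have df: "(f has_real_derivative (p x + p'' x) * sin (\<theta> - x)) (at x)" for x
    unfolding f_def
    using has_real_derivative_inner[OF support_curve_has_vector_derivative[OF dp dp']
        has_vector_derivative_const[of "dir \<theta>"], of x] sin_minus[of "x - \<theta>"] by simp
  have f\<theta>: "f \<theta> = p \<theta>" unfolding f_def support_curve_frame by (simp add: inner_add_left)
  have max: "f x \<le> p \<theta>" if x: "\<theta> - pi \<le> x" "x \<le> \<theta> + pi" for x
  proof (cases "x \<le> \<theta>")
    case True
    have "f x \<le> f \<theta>"
    proof (rule DERIV_nonneg_imp_nondecreasing[OF True])
      fix y assume "x \<le> y" "y \<le> \<theta>"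
      then have "0 \<le> sin (\<theta> - y)" using x by (intro sin_ge_zero) auto
      then show "\<exists>d. DERIV f y :> d \<and> 0 \<le> d" using df pos[of y] by (meson less_imp_le mult_nonneg_nonneg)
    qed
    then show ?thesis by (simp add: f\<theta>)
  next
    case False
    then have "\<theta> \<le> x" by simp
    then have "f \<theta> \<ge> f x"
    proof (rule DERIV_nonpos_imp_nonincreasing)
      fix y assume "\<theta> \<le> y" "y \<le> x"
      then have "0 \<le> sin (y - \<theta>)" using x by (intro sin_ge_zero) auto
      then have "sin (\<theta> - y) \<le> 0" using sin_minus[of "y - \<theta>"] by simp
      then show "\<exists>d. DERIV f y :> d \<and> d \<le> 0" using df pos[of y] by (meson less_imp_le mult_nonneg_nonpos)
    qed
    then show ?thesis by (simp add: f\<theta>)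
  qed
  have bound: "support_curve p x \<bullet> dir \<theta> \<le> p \<theta>" for x
  proof -
    interpret periodic_fun_simple "support_curve p" "2 * pi" by standard (rule cper)
    define n where "n = round ((\<theta> - x) / (2 * pi))"
    have "\<bar>of_int n - (\<theta> - x) / (2 * pi)\<bar> * (2 * pi) \<le> 1/2 * (2 * pi)"
      unfolding n_def by (intro mult_right_mono of_int_round_abs_le) auto
    then have "\<bar>(of_int n - (\<theta> - x) / (2 * pi)) * (2 * pi)\<bar> \<le> pi" by (simp add: abs_mult)
    moreover have "(a - y / (2 * pi)) * (2 * pi) = a * (2 * pi) - y" for a y :: real
      by (simp add: left_diff_distrib)
    ultimately have "\<bar>of_int n * (2 * pi) - (\<theta> - x)\<bar> \<le> pi" by metis
    then have "\<bar>x + of_int n * (2 * pi) - \<theta>\<bar> \<le> pi" by linarith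
    then have "f (x + of_int n * (2 * pi)) \<le> p \<theta>" by (intro max) auto
    then show ?thesis by (simp add: f_def plus_of_int)
  qed
  obtain n :: int where n: "0 \<le> \<theta> + of_int n * (2*pi)" "\<theta> + of_int n * (2*pi) < 2*pi"
    "support_curve p (\<theta> + of_int n * (2*pi)) = support_curve p \<theta>"
    using periodic_representative[where f = "support_curve p", OF cper, of \<theta>] by auto
  have "support_curve p \<theta> \<in> support_curve p ` {0..2*pi}"
    using n by (intro image_eqI[of _ _ "\<theta> + of_int n * (2*pi)"]) auto
  then have "support_fun (support_curve p ` {0..2*pi}) \<theta> = support_curve p \<theta> \<bullet> dir \<theta>"
    by (rule support_fun_eq_maximum) (use bound f\<theta> in \<open>auto simp: f_def\<close>)
  then show ?thesis using f\<theta> by (simp add: f_def)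
qed

text \<open>
  Since \<open>dir (x + \<pi>) = - dir x\<close>, the point of the curve at the opposite angle enters the
  difference with its support function added.
\<close>

lemma cwms_curve_eq_support_curve:
  assumes "\<And>x. (p has_real_derivative p' x) (at x)"
  shows "cwms_curve p L = support_curve (\<lambda>x. p x + p (x + pi) - L / pi)"
proof
  fix x
  have "((\<lambda>x. p (x + pi)) has_real_derivative p' (x + pi)) (at x)" for x
    using assms[of "x + pi"] by (simp add: DERIV_shift)
  then have "((\<lambda>x. p x + p (x + pi) - L / pi) has_real_derivative p' x + p' (x + pi)) (at x)"
    by (auto intro!: derivative_eq_intros assms)
  then have "deriv (\<lambda>x. p x + p (x + pi) - L / pi) x = p' x + p' (x + pi)" by (rule DERIV_imp_deriv)
  moreover have "deriv p y = p' y" for y using assms by (rule DERIV_imp_deriv)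
  ultimately show "cwms_curve p L x = support_curve (\<lambda>x. p x + p (x + pi) - L / pi) x"
    by (simp add: cwms_curve_def support_curve_def dir_def algebra_simps)
qed

section \<open>The area of the Constant Width Measure Set\<close>

theorem corollary6p7:
  fixes K W :: "plane set" and c :: "real \<Rightarrow> plane" and T L :: real and p :: "real \<Rightarrow> real"
  assumes K: "strictly_convex K" "0 \<in> interior K"
    and oval_K: "oval c T" "frontier K = c ` {0..T}"
  defines "L \<equiv> curve_length c T" and "p \<equiv> support_fun (frontier K)"
  assumes oval_W: "oval (wigner_curve p L) (2 * pi)"
    and W: "convex_body W" "frontier W = wigner_curve p L ` {0..2 * pi}"
  shows "\<bar>oriented_area (cwms_curve p L) (2 * pi)\<bar>
           \<ge> max (4 * pi * (d_inf K W)\<^sup>2) (6 * (d_two K W)\<^sup>2)"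
proof -
  have "interior K \<noteq> {}" using K by blast
  then obtain p' p'' where dp: "\<And>x. (p has_real_derivative p' x) (at x)"
    and dp': "\<And>x. (p' has_real_derivative p'' x) (at x)"
    and cp'': "continuous_on UNIV p''" and cauchy: "integral {0..2*pi} p = L"
    using oval_support_function[OF K(1) _ oval_K] unfolding p_def L_def by blast
  have per: "p (x + 2 * pi) = p x" for x by (simp add: p_def support_fun_periodic)
  have per': "p (x + pi + pi) = p x" for x using per[of x] by (simp add: add.assoc)
  have cp: "continuous_on UNIV p" "continuous_on UNIV p'"
    by (rule continuous_on_of_derivative, rule dp dp')+
  have dps: "((\<lambda>x. p (x + pi)) has_real_derivative p' (x + pi)) (at x)"
    and dps': "((\<lambda>x. p' (x + pi)) has_real_derivative p'' (x + pi)) (at x)" for x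
    using dp[of "x + pi"] dp'[of "x + pi"] by (simp_all add: DERIV_shift)
  obtain P where dP: "\<And>x. (P has_real_derivative p x) (at x)"
    using antiderivative_exists[OF cp(1)] by blast
  have dPs: "((\<lambda>x. P (x + pi)) has_real_derivative p (x + pi)) (at x)" for x
    using dP[of "x + pi"] by (simp add: DERIV_shift)
  have Pper: "P (a + 2*pi) - P a = L" for a
    using has_integral_derivative[OF dP, of a "a + 2*pi"] cauchy
      integral_periodic_shift[OF cp(1) per, of a 0] by (simp add: integral_unique)
  have L0: "0 \<le> L" unfolding L_def curve_length_def
    using oval_K(1) unfolding oval_def
    by (intro integral_nonneg integrable_continuous_real continuous_on_norm
        continuous_on_subset[OF smooth_curve_derivatives(3)]) auto

  define w where "w = wigner_support p L"
  define w' where "w' x = (p' x - p' (x + pi)) / 2" for x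
  define w'' where "w'' x = (p'' x - p'' (x + pi)) / 2" for x
  have dw: "(w has_real_derivative w' x) (at x)" for x
    unfolding w_def wigner_support_def[abs_def] w'_def
    by (auto intro!: derivative_eq_intros dp dps)
  have dw': "(w' has_real_derivative w'' x) (at x)" for x
    unfolding w'_def[abs_def] w''_def by (auto intro!: derivative_eq_intros dp' dps')
  have wper: "w (x + 2 * pi) = w x" for x
    using per[of x] per[of "x + pi"] by (simp add: w_def wigner_support_def add_ac)
  have wcurve: "wigner_curve p L = support_curve w" by (simp add: wigner_curve_def w_def)
  have wpos: "0 < w x + w'' x" for x
  proof -
    \<comment> \<open>An antiderivative of \<open>w + w''\<close>.  It grows by \<open>L\<close> over a full turn, because the integrals of
      \<open>p(x)\<close> and of \<open>p(x + \<pi>)\<close> cancel; this excludes the negative sign.\<close>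
    define R where "R x = L / (2*pi) * x + (P x - P (x + pi)) / 2 + w' x" for x
    have "(R has_real_derivative w x + w'' x) (at x)" for x
      unfolding R_def w_def wigner_support_def
      by (auto intro!: derivative_eq_intros dP dPs dw')
    moreover have "w x + w'' x \<noteq> 0" for x
    proof -
      have "vel (support_curve w) x = (w x + w'' x) *\<^sub>R tdir x"
        unfolding vel_def using support_curve_has_vector_derivative[OF dw dw'] by (rule vector_derivative_at)
      then show ?thesis using oval_W unfolding oval_def wcurve by (metis scaleR_zero_left)
    qed
    moreover have "continuous_on UNIV (\<lambda>x. w x + w'' x)"
      unfolding w''_def
      by (intro continuous_intros cp'' continuous_on_compose2[OF cp''] continuous_on_of_derivative[OF dw]) auto
    moreover have "R 0 \<le> R (2*pi)"
      using Pper[of 0] Pper[of pi] derivative_periodic[OF dw wper, of 0] L0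
      by (simp add: R_def add_ac field_simps)
    ultimately show ?thesis by (intro nonvanishing_imp_pos[of "\<lambda>x. w x + w'' x" R 0 "2*pi"]) auto
  qed
  have suppW: "support_fun (frontier W) \<theta> = w \<theta>" for \<theta>
    unfolding W(2) wcurve by (rule support_fun_support_curve[OF dw dw' wper wpos])

  define q where "q x = p x + p (x + pi) - L / pi" for x
  define q' where "q' x = p' x + p' (x + pi)" for x
  define q'' where "q'' x = p'' x + p'' (x + pi)" for x
  have dq: "(q has_real_derivative q' x) (at x)" for x
    unfolding q_def q'_def by (auto intro!: derivative_eq_intros dp dps)
  have dq': "(q' has_real_derivative q'' x) (at x)" for x
    unfolding q'_def[abs_def] q''_def by (auto intro!: derivative_eq_intros dp' dps')
  have cq: "continuous_on UNIV q" "continuous_on UNIV q'"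
    by (rule continuous_on_of_derivative, rule dq dq')+
  have qper: "q (x + pi) = q x" for x using per' by (simp add: q_def)
  have q'per: "q' (x + pi) = q' x" for x by (rule derivative_periodic[OF dq qper])
  have qper2: "q (x + 2 * pi) = q x" for x using qper[of x] qper[of "x + pi"] by (simp add: add.assoc)
  have qmean: "integral {0..pi} q = 0"
  proof -
    have "((\<lambda>x. P x + P (x + pi) - L / pi * x) has_real_derivative q x) (at x)" for x
      unfolding q_def by (auto intro!: derivative_eq_intros dP dPs)
    from has_integral_derivative[OF this, of 0 pi] Pper[of 0]
    show ?thesis by (simp add: integral_unique)
  qed
  have diff: "support_fun (frontier K) \<theta> - support_fun (frontier W) \<theta> = q \<theta> / 2" for \<theta>
    unfolding suppW w_def wigner_support_def q_def p_def[symmetric] by (simp add: field_simps)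

  define E where "E = integral {0..pi} (\<lambda>x. (q' x)\<^sup>2 - (q x)\<^sup>2)"
  have cE: "continuous_on UNIV (\<lambda>x. (q' x)\<^sup>2 - (q x)\<^sup>2)" by (intro continuous_intros cq)
  have area: "oriented_area (cwms_curve p L) (2 * pi) = - E"
  proof -
    have "cwms_curve p L = support_curve q"
      using cwms_curve_eq_support_curve[OF dp] by (simp add: q_def[abs_def])
    then have "oriented_area (cwms_curve p L) (2 * pi)
        = 1/2 * integral {0..2*pi} (\<lambda>x. - ((q' x)\<^sup>2 - (q x)\<^sup>2))"
      using oriented_area_support_curve[OF dq dq' qper2] by simp
    also have "\<dots> = - E"
      unfolding integral_neg E_def
      by (subst integral_double_period[OF cE]) (simp_all add: qper q'per)
    finally show ?thesis .
  qed

  have sup_bound: "pi * (q \<theta>)\<^sup>2 \<le> E" for \<theta>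
  proof -
    have "integral {\<theta>..\<theta> + pi} q = 0"
      using integral_periodic_shift[OF cq(1) qper, of \<theta> 0] qmean by simp
    then have "pi * (q \<theta>)\<^sup>2 \<le> integral {\<theta>..\<theta> + pi} (\<lambda>x. (q' x)\<^sup>2 - (q x)\<^sup>2)"
      using mean_zero_pointwise_bound[OF dq cq(2) qper] by blast
    also have "\<dots> = integral {0..0 + pi} (\<lambda>x. (q' x)\<^sup>2 - (q x)\<^sup>2)"
      by (rule integral_periodic_shift[OF cE]) (simp_all add: qper q'per)
    finally show ?thesis by (simp add: E_def)
  qed
  have E0: "0 \<le> E" using sup_bound[of 0] by (meson order_trans mult_nonneg_nonneg pi_ge_zero zero_le_power2)
  have half: "\<bar>q \<theta> / 2\<bar> \<le> sqrt (E / (4 * pi))" for \<theta>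
    using sup_bound[of \<theta>] by (intro real_le_rsqrt) (simp add: power_divide field_simps)
  have dinf: "0 \<le> d_inf K W" "d_inf K W \<le> sqrt (E / (4 * pi))"
  proof -
    have "bdd_above (range (\<lambda>\<theta>. \<bar>q \<theta> / 2\<bar>))" using half by (intro bdd_aboveI2)
    then have "\<bar>q 0 / 2\<bar> \<le> d_inf K W" unfolding d_inf_def diff by (intro cSUP_upper) auto
    then show "0 \<le> d_inf K W" by linarith
    show "d_inf K W \<le> sqrt (E / (4 * pi))" unfolding d_inf_def diff
      using half by (intro cSUP_least) auto
  qed
  have "(d_inf K W)\<^sup>2 \<le> (sqrt (E / (4 * pi)))\<^sup>2" using dinf by (intro power_mono) auto
  then have first: "4 * pi * (d_inf K W)\<^sup>2 \<le> E" using E0 by (simp add: field_simps)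

  have second: "6 * (d_two K W)\<^sup>2 \<le> E"
  proof -
    have cq2: "continuous_on UNIV (\<lambda>x. (q x)\<^sup>2)" by (intro continuous_intros cq)
    have "(d_two K W)\<^sup>2 = integral {0..2*pi} (\<lambda>x. (q x)\<^sup>2 / 4)"
      unfolding d_two_def diff by (subst real_sqrt_pow2)
        (auto intro!: integral_nonneg integrable_continuous_real continuous_on_divide
          continuous_on_subset[OF cq2] simp: power_divide)
    also have "\<dots> = integral {0..pi} (\<lambda>x. (q x)\<^sup>2) / 2"
      using integral_double_period[OF cq2, of pi] by (simp add: qper)
    finally have d2: "6 * (d_two K W)\<^sup>2 = 3 * integral {0..pi} (\<lambda>x. (q x)\<^sup>2)" by simp
    have "0 \<le> integral {0..pi} (\<lambda>x. (q' x)\<^sup>2 - 4 * (q x)\<^sup>2)"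
      using wirtinger_periodic[OF dq cq(2) pi_gt_zero qper qmean] by simp
    also have "\<dots> = integral {0..pi} (\<lambda>x. ((q' x)\<^sup>2 - (q x)\<^sup>2) - 3 * (q x)\<^sup>2)" by simp
    also have "\<dots> = E - 3 * integral {0..pi} (\<lambda>x. (q x)\<^sup>2)"
      unfolding E_def
      by (subst integral_diff) (auto intro!: integrable_continuous_real continuous_intros
          continuous_on_subset[OF cq(1)] continuous_on_subset[OF cq(2)])
    finally show ?thesis unfolding d2 by simp
  qed
  show ?thesis using first second E0 by (simp add: area)
qed

end
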